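(* Let $(\mathbb A,\mathsf E,\mathsf M)$ be a context and $X$ an object of $\mathbb A$. Define $\Phi:\mathtt{EGM}(X)\to\mathrm{pnhd}[X]^{\mathrm{op}}$ by $\Phi(c)(x)=\{p\in\mathrm{Sub}(X): c(x)\leq p\}$ and $\Psi:\mathrm{pnhd}[X]^{\mathrm{op}}\to\mathtt{EGM}(X)$ by $\Psi(\mu)(x)=\bigwedge\mu(x)$ ($x\in\mathrm{Sub}(X)$). Then $\Phi$ is left adjoint to $\Psi$ (as order preserving maps between posets) and $\Psi\circ\Phi=\mathrm{id}_{\mathtt{EGM}(X)}$.
   Context: A context is a triple $(\mathbb A,\mathsf E,\mathsf M)$ where $\mathbb A$ is a finitely complete category with finite coproducts, $(\mathsf E,\mathsf M)$ is a proper factorization system on $\mathbb A$ ($\mathsf E\subseteq$ epimorphisms, $\mathsf M\subseteq$ monomorphisms), and for each object $X$ the poset $\mathrm{Sub}(X)$ of admissible subobjects of $X$ ($\mathsf M$-morphisms with codomain $X$, equivalent ones identified) is a complete lattice, with largest element $\mathrm{id}_X$ and smallest element $\sigma_X$ (the $\mathsf M$-part of the factorization of the unique morphism from the initial object to $X$). A filter on $X$ is an up-closed subset of $\mathrm{Sub}(X)$ closed under finite meets; filters $\mathrm{Fil}(X)$ are ordered by inclusion. A preneighbourhood system on $X$ is an order preserving map $\mu:\mathrm{Sub}(X)^{\mathrm{op}}\to\mathrm{Fil}(X)$ with $\mu(\sigma_X)=\mathrm{Sub}(X)$ and $p\in\mu(m)\Rightarrow m\leq p$. $\mathrm{pnhd}[X]$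 is the set of preneighbourhood systems on $X$ ordered by pointwise inclusion. $\mathtt{EGM}(X)$ is the set, ordered pointwise, of closure operations on $\mathrm{Sub}(X)$, i.e. order preserving endomaps $c$ of $\mathrm{Sub}(X)$ with $x\leq c(x)$ for all $x$ and $c(\sigma_X)=\sigma_X$. *)

theory Defs
  imports "HOL-Algebra.Galois_Connection"
begin

section \<open>Categories\<close>

record ('o, 'a) category =
  Obj  :: "'o set"
  Arr  :: "'a set"
  Dom  :: "'a \<Rightarrow> 'o"
  Cod  :: "'a \<Rightarrow> 'o"
  Id   :: "'o \<Rightarrow> 'a"
  Comp :: "'a \<Rightarrow> 'a \<Rightarrow> 'a" (infixr \<open>\<odot>\<index>\<close> 75)

definition Hom :: "('o, 'a) category \<Rightarrow> 'o \<Rightarrow> 'o \<Rightarrow> 'a set" where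
  "Hom C X Y = {f \<in> Arr C. Dom C f = X \<and> Cod C f = Y}"

text \<open>Composition is in applicative order: \<open>g \<odot> f\<close> is "first f, then g". Its value is
  unconstrained when \<open>Cod f \<noteq> Dom g\<close>.\<close>

locale category =
  fixes C :: "('o, 'a) category" (structure)
  assumes Dom_Obj: "f \<in> Arr C \<Longrightarrow> Dom C f \<in> Obj C"
    and Cod_Obj: "f \<in> Arr C \<Longrightarrow> Cod C f \<in> Obj C"
    and Id_Hom: "X \<in> Obj C \<Longrightarrow> Id C X \<in> Hom C X X"
    and Comp_Hom: "f \<in> Hom C X Y \<Longrightarrow> g \<in> Hom C Y Z \<Longrightarrow> g \<odot> f \<in> Hom C X Z"
    and Id_left: "f \<in> Hom C X Y \<Longrightarrow> Id C Y \<odot> f = f"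
    and Id_right: "f \<in> Hom C X Y \<Longrightarrow> f \<odot> Id C X = f"
    and Comp_assoc: "f \<in> Hom C W X \<Longrightarrow> g \<in> Hom C X Y \<Longrightarrow> h \<in> Hom C Y Z \<Longrightarrow>
      (h \<odot> g) \<odot> f = h \<odot> (g \<odot> f)"

definition monic :: "('o, 'a) category \<Rightarrow> 'a \<Rightarrow> bool" where
  "monic C m \<longleftrightarrow> m \<in> Arr C \<and>
    (\<forall>W. \<forall>f \<in> Hom C W (Dom C m). \<forall>g \<in> Hom C W (Dom C m). m \<odot>\<^bsub>C\<^esub> f = m \<odot>\<^bsub>C\<^esub> g \<longrightarrow> f = g)"

definition epic :: "('o, 'a) category \<Rightarrow> 'a \<Rightarrow> bool" where
  "epic C e \<longleftrightarrow> e \<in> Arr C \<and>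
    (\<forall>W. \<forall>f \<in> Hom C (Cod C e) W. \<forall>g \<in> Hom C (Cod C e) W. f \<odot>\<^bsub>C\<^esub> e = g \<odot>\<^bsub>C\<^esub> e \<longrightarrow> f = g)"


section \<open>Finite limits and finite coproducts\<close>

definition is_functor ::
  "('i, 'j) category \<Rightarrow> ('o, 'a) category \<Rightarrow> ('i \<Rightarrow> 'o) \<Rightarrow> ('j \<Rightarrow> 'a) \<Rightarrow> bool" where
  "is_functor J C F0 F1 \<longleftrightarrow> category J \<and> category C \<and>
    (\<forall>i \<in> Obj J. F0 i \<in> Obj C \<and> F1 (Id J i) = Id C (F0 i)) \<and>
    (\<forall>u \<in> Arr J. F1 u \<in> Hom C (F0 (Dom J u)) (F0 (Cod J u))) \<and>
    (\<forall>u \<in> Arr J. \<forall>v \<in> Arr J. Cod J u = Dom J v \<longrightarrow>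
      F1 (v \<odot>\<^bsub>J\<^esub> u) = F1 v \<odot>\<^bsub>C\<^esub> F1 u)"

definition is_cone ::
  "('i, 'j) category \<Rightarrow> ('o, 'a) category \<Rightarrow> ('i \<Rightarrow> 'o) \<Rightarrow> ('j \<Rightarrow> 'a) \<Rightarrow> 'o \<Rightarrow> ('i \<Rightarrow> 'a) \<Rightarrow> bool"
  where
  "is_cone J C F0 F1 L p \<longleftrightarrow> L \<in> Obj C \<and>
    (\<forall>i \<in> Obj J. p i \<in> Hom C L (F0 i)) \<and>
    (\<forall>u \<in> Arr J. F1 u \<odot>\<^bsub>C\<^esub> p (Dom J u) = p (Cod J u))"

definition is_limit ::
  "('i, 'j) category \<Rightarrow> ('o, 'a) category \<Rightarrow> ('i \<Rightarrow> 'o) \<Rightarrow> ('j \<Rightarrow> 'a) \<Rightarrow> 'o \<Rightarrow> ('i \<Rightarrow> 'a) \<Rightarrow> bool"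
  where
  "is_limit J C F0 F1 L p \<longleftrightarrow> is_cone J C F0 F1 L p \<and>
    (\<forall>L' q. is_cone J C F0 F1 L' q \<longrightarrow>
      (\<exists>!h. h \<in> Hom C L' L \<and> (\<forall>i \<in> Obj J. p i \<odot>\<^bsub>C\<^esub> h = q i)))"

text \<open>Every finite category is isomorphic to one whose objects and arrows are natural numbers,
  so it suffices to quantify over index categories carried by type \<^typ>\<open>nat\<close>.\<close>

definition finitely_complete :: "('o, 'a) category \<Rightarrow> bool" where
  "finitely_complete C \<longleftrightarrow>
    (\<forall>(J :: (nat, nat) category) F0 F1.
      finite (Obj J) \<and> finite (Arr J) \<and> is_functor J C F0 F1 \<longrightarrow> (\<exists>L p. is_limit J C F0 F1 L p))"

definition is_coproduct ::
  "('o, 'a) category \<Rightarrow> 'i set \<Rightarrow> ('i \<Rightarrow> 'o) \<Rightarrow> 'o \<Rightarrow> ('i \<Rightarrow> 'a) \<Rightarrow> bool" where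
  "is_coproduct C I D S \<iota> \<longleftrightarrow> S \<in> Obj C \<and> (\<forall>i \<in> I. \<iota> i \<in> Hom C (D i) S) \<and>
    (\<forall>T \<in> Obj C. \<forall>g. (\<forall>i \<in> I. g i \<in> Hom C (D i) T) \<longrightarrow>
      (\<exists>!h. h \<in> Hom C S T \<and> (\<forall>i \<in> I. h \<odot>\<^bsub>C\<^esub> \<iota> i = g i)))"

definition has_finite_coproducts :: "('o, 'a) category \<Rightarrow> bool" where
  "has_finite_coproducts C \<longleftrightarrow>
    (\<forall>(I :: nat set) D. finite I \<and> D ` I \<subseteq> Obj C \<longrightarrow> (\<exists>S \<iota>. is_coproduct C I D S \<iota>))"

definition is_initial :: "('o, 'a) category \<Rightarrow> 'o \<Rightarrow> bool" where
  "is_initial C Z \<longleftrightarrow> Z \<in> Obj C \<and> (\<forall>X \<in> Obj C. \<exists>!f. f \<in> Hom C Z X)"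


section \<open>Proper factorization systems and admissible subobjects\<close>

definition orthogonal :: "('o, 'a) category \<Rightarrow> 'a \<Rightarrow> 'a \<Rightarrow> bool" where
  "orthogonal C e m \<longleftrightarrow>
    (\<forall>u \<in> Hom C (Dom C e) (Dom C m). \<forall>v \<in> Hom C (Cod C e) (Cod C m).
      m \<odot>\<^bsub>C\<^esub> u = v \<odot>\<^bsub>C\<^esub> e \<longrightarrow>
      (\<exists>!d. d \<in> Hom C (Cod C e) (Dom C m) \<and> d \<odot>\<^bsub>C\<^esub> e = u \<and> m \<odot>\<^bsub>C\<^esub> d = v))"

locale factorization_system = category +
  fixes E M :: "'a set"
  assumes E_eq: "E = {e \<in> Arr C. \<forall>m \<in> M. orthogonal C e m}"
    and M_eq: "M = {m \<in> Arr C. \<forall>e \<in> E. orthogonal C e m}"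
    and factorization: "f \<in> Arr C \<Longrightarrow> \<exists>e \<in> E. \<exists>m \<in> M. Cod C e = Dom C m \<and> f = m \<odot> e"

locale proper_factorization_system = factorization_system +
  assumes E_epic: "e \<in> E \<Longrightarrow> epic C e"
    and M_monic: "m \<in> M \<Longrightarrow> monic C m"

definition adm :: "('o, 'a) category \<Rightarrow> 'a set \<Rightarrow> 'o \<Rightarrow> 'a set" where
  "adm C M X = {m \<in> M. Cod C m = X}"

definition factors_through :: "('o, 'a) category \<Rightarrow> 'a \<Rightarrow> 'a \<Rightarrow> bool" where
  "factors_through C m n \<longleftrightarrow> (\<exists>k \<in> Hom C (Dom C m) (Dom C n). m = n \<odot>\<^bsub>C\<^esub> k)"

definition adm_equiv :: "('o, 'a) category \<Rightarrow> 'a set \<Rightarrow> 'o \<Rightarrow> ('a \<times> 'a) set" where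
  "adm_equiv C M X = {(m, n). m \<in> adm C M X \<and> n \<in> adm C M X \<and>
    factors_through C m n \<and> factors_through C n m}"

definition Sub :: "('o, 'a) category \<Rightarrow> 'a set \<Rightarrow> 'o \<Rightarrow> 'a set gorder" where
  "Sub C M X =
    \<lparr> carrier = adm C M X // adm_equiv C M X,
      eq = (=),
      le = (\<lambda>x y. \<exists>m \<in> x. \<exists>n \<in> y. factors_through C m n) \<rparr>"

text \<open>The smallest admissible subobject \<open>\<sigma>\<^sub>X\<close>: the class of the \<open>M\<close>-part of a factorization of
  the morphism from an initial object to \<open>X\<close>. In a proper factorization system this class does
  not depend on the initial object or on the factorization.\<close>

definition sigma :: "('o, 'a) category \<Rightarrow> 'a set \<Rightarrow> 'a set \<Rightarrow> 'o \<Rightarrow> 'a set" where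
  "sigma C E M X = (THE s. \<exists>Z e m. is_initial C Z \<and> e \<in> E \<and> m \<in> M \<and> Cod C e = Dom C m \<and>
    m \<odot>\<^bsub>C\<^esub> e \<in> Hom C Z X \<and> s = adm_equiv C M X `` {m})"

locale neighbourhood_context = proper_factorization_system +
  assumes finitely_complete: "finitely_complete C"
    and has_finite_coproducts: "has_finite_coproducts C"
    and Sub_complete_lattice: "X \<in> Obj C \<Longrightarrow> complete_lattice (Sub C M X)"


section \<open>Filters, preneighbourhood systems and closure operations\<close>

text \<open>The empty meet is included, so every filter contains the largest element. The improper
  filter, consisting of all admissible subobjects, is allowed.\<close>

definition Fil :: "('o, 'a) category \<Rightarrow> 'a set \<Rightarrow> 'o \<Rightarrow> 'a set set gorder" where
  "Fil C M X =
    \<lparr> carrier = {F. F \<subseteq> carrier (Sub C M X) \<and>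
        (\<forall>p \<in> F. \<forall>q \<in> carrier (Sub C M X). p \<sqsubseteq>\<^bsub>Sub C M X\<^esub> q \<longrightarrow> q \<in> F) \<and>
        (\<forall>S. S \<subseteq> F \<and> finite S \<longrightarrow> \<Sqinter>\<^bsub>Sub C M X\<^esub> S \<in> F)},
      eq = (=),
      le = (\<subseteq>) \<rparr>"

text \<open>Maps out of \<open>Sub X\<close> are represented by extensional functions (undefined off the carrier),
  so that equality of HOL functions is equality of maps.\<close>

definition pnhd ::
  "('o, 'a) category \<Rightarrow> 'a set \<Rightarrow> 'a set \<Rightarrow> 'o \<Rightarrow> ('a set \<Rightarrow> 'a set set) gorder" where
  "pnhd C E M X =
    \<lparr> carrier = {\<mu> \<in> carrier (Sub C M X) \<rightarrow>\<^sub>E carrier (Fil C M X).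
        isotone (inv_gorder (Sub C M X)) (Fil C M X) \<mu> \<and>
        \<mu> (sigma C E M X) = carrier (Sub C M X) \<and>
        (\<forall>m \<in> carrier (Sub C M X). \<forall>p \<in> \<mu> m. m \<sqsubseteq>\<^bsub>Sub C M X\<^esub> p)},
      eq = (=),
      le = (\<lambda>\<mu> \<nu>. \<forall>x \<in> carrier (Sub C M X). \<mu> x \<sqsubseteq>\<^bsub>Fil C M X\<^esub> \<nu> x) \<rparr>"

definition EGM ::
  "('o, 'a) category \<Rightarrow> 'a set \<Rightarrow> 'a set \<Rightarrow> 'o \<Rightarrow> ('a set \<Rightarrow> 'a set) gorder" where
  "EGM C E M X =
    \<lparr> carrier = {c \<in> carrier (Sub C M X) \<rightarrow>\<^sub>E carrier (Sub C M X).
        isotone (Sub C M X) (Sub C M X) c \<and>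
        (\<forall>x \<in> carrier (Sub C M X). x \<sqsubseteq>\<^bsub>Sub C M X\<^esub> c x) \<and>
        c (sigma C E M X) = sigma C E M X},
      eq = (=),
      le = (\<lambda>c d. \<forall>x \<in> carrier (Sub C M X). c x \<sqsubseteq>\<^bsub>Sub C M X\<^esub> d x) \<rparr>"

definition Phi ::
  "('o, 'a) category \<Rightarrow> 'a set \<Rightarrow> 'o \<Rightarrow> ('a set \<Rightarrow> 'a set) \<Rightarrow> ('a set \<Rightarrow> 'a set set)" where
  "Phi C M X c =
    (\<lambda>x \<in> carrier (Sub C M X). {p \<in> carrier (Sub C M X). c x \<sqsubseteq>\<^bsub>Sub C M X\<^esub> p})"

definition Psi ::
  "('o, 'a) category \<Rightarrow> 'a set \<Rightarrow> 'o \<Rightarrow> ('a set \<Rightarrow> 'a set set) \<Rightarrow> ('a set \<Rightarrow> 'a set)" where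
  "Psi C M X \<mu> = (\<lambda>x \<in> carrier (Sub C M X). \<Sqinter>\<^bsub>Sub C M X\<^esub> (\<mu> x))"

end

theory Submission
  imports Defs
begin

text \<open>
  For \<open>F \<subseteq> Sub X\<close> and \<open>a \<in> Sub X\<close>, the set \<open>F\<close> is contained in the principal filter of \<open>a\<close>
  exactly when \<open>a\<close> is a lower bound of \<open>F\<close>, that is, when \<open>a \<sqsubseteq> \<Sqinter>F\<close>. Taking \<open>a = c x\<close> and
  \<open>F = \<mu> x\<close> pointwise turns \<open>\<mu> \<le> \<Phi> c\<close> into \<open>c \<le> \<Psi> \<mu>\<close>, which is the adjunction into the
  opposite order; and \<open>\<Psi> \<circ> \<Phi>\<close> is the identity because a principal filter has its generator as
  infimum.

  The category enters only through \<open>\<sigma>\<^sub>X\<close>: for \<open>\<Phi> c\<close> and \<open>\<Psi> \<mu>\<close> to satisfy the normalization at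
  \<open>\<sigma>\<^sub>X\<close>, this class has to be the least element of the lattice. An empty coproduct is an initial
  object, so there is a morphism to factor; orthogonality of its \<open>E\<close>-part to every \<open>M\<close>-morphism
  into \<open>X\<close> then makes its \<open>M\<close>-part factor through all of them (\<open>initial_image_factors\<close>).
  Antisymmetry of the order makes the class unique, so the definite description of \<open>\<sigma>\<^sub>X\<close>
  denotes it (\<open>sigma_least\<close>).
\<close>

section \<open>The posets of filters, preneighbourhood systems and closure operations\<close>

lemma partial_orderI:
  fixes L (structure)
  assumes eq: "(.=) = (=)"
    and le_refl: "\<And>x. x \<in> carrier L \<Longrightarrow> x \<sqsubseteq> x"
    and le_antisym: "\<And>x y. x \<in> carrier L \<Longrightarrow> y \<in> carrier L \<Longrightarrow> x \<sqsubseteq> y \<Longrightarrow> y \<sqsubseteq> x \<Longrightarrow> x = y"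
    and le_trans: "\<And>x y z. x \<sqsubseteq> y \<Longrightarrow> y \<sqsubseteq> z \<Longrightarrow> x \<in> carrier L \<Longrightarrow> y \<in> carrier L \<Longrightarrow>
      z \<in> carrier L \<Longrightarrow> x \<sqsubseteq> z"
  shows "partial_order L"
  by unfold_locales (simp_all add: eq le_refl le_antisym, metis le_trans)

lemma carrier_EGM_iff:
  "c \<in> carrier (EGM C E M X) \<longleftrightarrow>
    c \<in> carrier (Sub C M X) \<rightarrow>\<^sub>E carrier (Sub C M X) \<and>
    isotone (Sub C M X) (Sub C M X) c \<and>
    (\<forall>x \<in> carrier (Sub C M X). x \<sqsubseteq>\<^bsub>Sub C M X\<^esub> c x) \<and>
    c (sigma C E M X) = sigma C E M X"
  by (simp add: EGM_def)

lemma carrier_pnhd_iff: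
  "\<mu> \<in> carrier (pnhd C E M X) \<longleftrightarrow>
    \<mu> \<in> carrier (Sub C M X) \<rightarrow>\<^sub>E carrier (Fil C M X) \<and>
    isotone (inv_gorder (Sub C M X)) (Fil C M X) \<mu> \<and>
    \<mu> (sigma C E M X) = carrier (Sub C M X) \<and>
    (\<forall>m \<in> carrier (Sub C M X). \<forall>p \<in> \<mu> m. m \<sqsubseteq>\<^bsub>Sub C M X\<^esub> p)"
  by (simp add: pnhd_def)

lemma le_EGM_iff:
  "c \<sqsubseteq>\<^bsub>EGM C E M X\<^esub> d \<longleftrightarrow> (\<forall>x \<in> carrier (Sub C M X). c x \<sqsubseteq>\<^bsub>Sub C M X\<^esub> d x)"
  by (simp add: EGM_def)

lemma le_pnhd_iff:
  "\<mu> \<sqsubseteq>\<^bsub>pnhd C E M X\<^esub> \<nu> \<longleftrightarrow> (\<forall>x \<in> carrier (Sub C M X). \<mu> x \<subseteq> \<nu> x)"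
  by (simp add: pnhd_def Fil_def)

lemma partial_order_Fil: "partial_order (Fil C M X)"
  by unfold_locales (auto simp: Fil_def)

lemma Fil_subset: "F \<in> carrier (Fil C M X) \<Longrightarrow> F \<subseteq> carrier (Sub C M X)"
  by (simp add: Fil_def)

lemma pnhd_subset:
  assumes "\<mu> \<in> carrier (pnhd C E M X)" and "x \<in> carrier (Sub C M X)"
  shows "\<mu> x \<subseteq> carrier (Sub C M X)"
proof (rule Fil_subset)
  have "\<mu> \<in> carrier (Sub C M X) \<rightarrow>\<^sub>E carrier (Fil C M X)"
    using assms(1) by (simp add: carrier_pnhd_iff)
  then show "\<mu> x \<in> carrier (Fil C M X)"
    using assms(2) by (rule PiE_mem)
qed

lemma partial_order_pnhd: "partial_order (pnhd C E M X)"
proof -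
  have eq: "(.=\<^bsub>pnhd C E M X\<^esub>) = (=)"
    by (simp add: pnhd_def)
  have antisym: "\<mu> = \<nu>"
    if "\<mu> \<in> carrier (pnhd C E M X)" "\<nu> \<in> carrier (pnhd C E M X)"
      "\<mu> \<sqsubseteq>\<^bsub>pnhd C E M X\<^esub> \<nu>" "\<nu> \<sqsubseteq>\<^bsub>pnhd C E M X\<^esub> \<mu>" for \<mu> \<nu>
  proof (rule PiE_ext)
    show "\<mu> \<in> carrier (Sub C M X) \<rightarrow>\<^sub>E carrier (Fil C M X)"
      "\<nu> \<in> carrier (Sub C M X) \<rightarrow>\<^sub>E carrier (Fil C M X)"
      using that by (simp_all add: carrier_pnhd_iff)
    show "\<mu> x = \<nu> x" if "x \<in> carrier (Sub C M X)" for x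
      using that \<open>\<mu> \<sqsubseteq>\<^bsub>pnhd C E M X\<^esub> \<nu>\<close> \<open>\<nu> \<sqsubseteq>\<^bsub>pnhd C E M X\<^esub> \<mu>\<close> by (simp add: le_pnhd_iff subset_antisym)
  qed
  show ?thesis
    by (rule partial_orderI[OF eq _ antisym]) (auto simp: le_pnhd_iff)
qed

lemma (in neighbourhood_context) partial_order_EGM:
  assumes X: "X \<in> Obj C"
  shows "partial_order (EGM C E M X)"
proof -
  interpret L: complete_lattice "Sub C M X"
    by (rule Sub_complete_lattice[OF X])
  have eq: "(.=\<^bsub>EGM C E M X\<^esub>) = (=)"
    by (simp add: EGM_def)
  have closed: "c x \<in> carrier (Sub C M X)"
    if "c \<in> carrier (EGM C E M X)" "x \<in> carrier (Sub C M X)" for c x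
    using that by (auto simp: carrier_EGM_iff)
  have le_antisym: "c = d"
    if c: "c \<in> carrier (EGM C E M X)" and d: "d \<in> carrier (EGM C E M X)"
      and le: "c \<sqsubseteq>\<^bsub>EGM C E M X\<^esub> d" "d \<sqsubseteq>\<^bsub>EGM C E M X\<^esub> c" for c d
  proof (rule PiE_ext)
    show "c \<in> carrier (Sub C M X) \<rightarrow>\<^sub>E carrier (Sub C M X)"
      "d \<in> carrier (Sub C M X) \<rightarrow>\<^sub>E carrier (Sub C M X)"
      using c d by (simp_all add: carrier_EGM_iff)
    show "c x = d x" if "x \<in> carrier (Sub C M X)" for x
      using that le closed[OF c that] closed[OF d that] by (simp add: le_EGM_iff L.le_antisym)
  qed
  have le_trans: "c \<sqsubseteq>\<^bsub>EGM C E M X\<^esub> f"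
    if "c \<sqsubseteq>\<^bsub>EGM C E M X\<^esub> d" "d \<sqsubseteq>\<^bsub>EGM C E M X\<^esub> f" "c \<in> carrier (EGM C E M X)"
      "d \<in> carrier (EGM C E M X)" "f \<in> carrier (EGM C E M X)" for c d f
    unfolding le_EGM_iff
  proof
    fix x
    assume x: "x \<in> carrier (Sub C M X)"
    show "c x \<sqsubseteq>\<^bsub>Sub C M X\<^esub> f x"
      by (rule L.le_trans[of _ "d x"]) (use x that closed in \<open>simp_all add: le_EGM_iff\<close>)
  qed
  have le_refl: "c \<sqsubseteq>\<^bsub>EGM C E M X\<^esub> c" if "c \<in> carrier (EGM C E M X)" for c
    using closed[OF that] by (simp add: le_EGM_iff)
  show ?thesis
    by (rule partial_orderI[OF eq le_refl le_antisym le_trans])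
qed

section \<open>The least admissible subobject\<close>

lemma (in category) factors_through_refl:
  assumes "m \<in> Arr C"
  shows "factors_through C m m"
proof -
  have "m \<in> Hom C (Dom C m) (Cod C m)"
    using assms by (simp add: Hom_def)
  then have "m = m \<odot> Id C (Dom C m)"
    by (simp add: Id_right)
  then show ?thesis
    unfolding factors_through_def using Id_Hom Dom_Obj assms by blast
qed

text \<open>With \<open>u\<close> the unique morphism from \<open>Z\<close> to the domain of \<open>n\<close>, initiality makes the square
  \<open>n \<odot> u = m \<odot> e\<close> commute; its diagonal, which exists as \<open>e\<close> is orthogonal to \<open>n\<close>, is the
  factorization of \<open>m\<close> through \<open>n\<close>.\<close>

lemma (in factorization_system) initial_image_factors:
  assumes Z: "is_initial C Z" and e: "e \<in> E" and m: "m \<in> M" and em: "Cod C e = Dom C m"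
    and me: "m \<odot> e \<in> Hom C Z X" and dom_e: "Dom C e = Z" and n: "n \<in> adm C M X"
    and cod_m: "Cod C m = X"
  shows "factors_through C m n"
proof -
  have nM: "n \<in> M" and cod_n: "Cod C n = X"
    using n by (auto simp: adm_def)
  have arr: "e \<in> Arr C" "m \<in> Arr C" "n \<in> Arr C"
    using e m nM E_eq M_eq by blast+
  have X: "X \<in> Obj C"
    using arr Cod_Obj cod_m by blast
  obtain u where u: "u \<in> Hom C Z (Dom C n)"
    using Z Dom_Obj[OF arr(3)] unfolding is_initial_def by blast
  have n_hom: "n \<in> Hom C (Dom C n) X"
    using arr cod_n by (simp add: Hom_def)
  have "n \<odot> u \<in> Hom C Z X"
    using Comp_Hom[OF u n_hom] .
  then have "n \<odot> u = m \<odot> e"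
    using Z X me unfolding is_initial_def by blast
  moreover have "orthogonal C e n"
    using e nM E_eq by blast
  moreover have "m \<in> Hom C (Cod C e) (Cod C n)"
    using arr em cod_m cod_n by (simp add: Hom_def)
  ultimately obtain d where "d \<in> Hom C (Cod C e) (Dom C n)" "n \<odot> d = m"
    using u dom_e unfolding orthogonal_def by blast
  then show ?thesis
    unfolding factors_through_def em by auto
qed

context neighbourhood_context
begin

lemma initial_exists: "\<exists>Z. is_initial C Z"
proof -
  obtain S \<iota> where "is_coproduct C ({} :: nat set) (\<lambda>_. undefined) S \<iota>"
    using has_finite_coproducts unfolding has_finite_coproducts_def by blast
  then show ?thesis
    by (auto simp: is_coproduct_def is_initial_def)
qed

text \<open>Any class meeting the description of \<open>\<sigma>\<^sub>X\<close> lies below every subobject, hence any two of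
  them agree by antisymmetry; this is what makes the definite description legitimate.\<close>

lemma sigma_least:
  assumes X: "X \<in> Obj C"
  shows "least (Sub C M X) (sigma C E M X) (carrier (Sub C M X))"
proof -
  interpret L: complete_lattice "Sub C M X"
    by (rule Sub_complete_lattice[OF X])
  have M_Arr: "m \<in> Arr C" if "m \<in> M" for m
    using that M_eq by blast
  have E_Arr: "e \<in> Arr C" if "e \<in> E" for e
    using that E_eq by blast
  have self: "n \<in> adm_equiv C M X `` {n}" if "n \<in> adm C M X" for n
    using that M_Arr by (auto simp: adm_equiv_def adm_def factors_through_refl)
  define P where "P s \<longleftrightarrow> (\<exists>Z e m. is_initial C Z \<and> e \<in> E \<and> m \<in> M \<and> Cod C e = Dom C m \<and>
    m \<odot> e \<in> Hom C Z X \<and> s = adm_equiv C M X `` {m})" for s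
  have P_least: "least (Sub C M X) s (carrier (Sub C M X))" if Ps: "P s" for s
  proof -
    obtain Z e m where Z: "is_initial C Z" and e: "e \<in> E" and m: "m \<in> M"
      and em: "Cod C e = Dom C m" and me: "m \<odot> e \<in> Hom C Z X"
      and s: "s = adm_equiv C M X `` {m}"
      using Ps unfolding P_def by blast
    have "m \<odot> e \<in> Hom C (Dom C e) (Cod C m)"
      by (rule Comp_Hom[of _ _ "Dom C m"]) (use e m em E_Arr M_Arr in \<open>auto simp: Hom_def\<close>)
    then have dom_e: "Dom C e = Z" and cod_m: "Cod C m = X"
      using me by (auto simp: Hom_def)
    then have m_adm: "m \<in> adm C M X"
      using m by (simp add: adm_def)
    have "s \<sqsubseteq>\<^bsub>Sub C M X\<^esub> x" if x: "x \<in> carrier (Sub C M X)" for x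
    proof -
      obtain n where n: "n \<in> adm C M X" "x = adm_equiv C M X `` {n}"
        using x by (auto simp: Sub_def quotient_def)
      have "factors_through C m n"
        by (rule initial_image_factors[OF Z e m em me dom_e n(1) cod_m])
      then show ?thesis
        using self[OF m_adm] self[OF n(1)] by (auto simp: Sub_def s n(2))
    qed
    moreover have "s \<in> carrier (Sub C M X)"
      using m_adm by (auto simp: Sub_def s quotient_def)
    ultimately show ?thesis
      by (simp add: least_def)
  qed
  have "\<exists>s. P s"
  proof -
    obtain Z where Z: "is_initial C Z"
      using initial_exists by blast
    then obtain f where f: "f \<in> Hom C Z X"
      using X unfolding is_initial_def by blast
    then obtain e m where "e \<in> E" "m \<in> M" "Cod C e = Dom C m" "f = m \<odot> e"
      using factorization[of f] by (auto simp: Hom_def)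
    then show ?thesis
      using Z f unfolding P_def by blast
  qed
  moreover have "s = t" if "P s" "P t" for s t
    using L.weak_least_unique[OF P_least[OF that(1)] P_least[OF that(2)]]
    by (simp add: Sub_def)
  ultimately have "P (THE s. P s)"
    by (metis theI)
  then have "P (sigma C E M X)"
    unfolding sigma_def P_def .
  then show ?thesis
    by (rule P_least)
qed

end


section \<open>The adjunction\<close>

context neighbourhood_context
begin

lemma principal_filter:
  assumes X: "X \<in> Obj C" and a: "a \<in> carrier (Sub C M X)"
  shows "{p \<in> carrier (Sub C M X). a \<sqsubseteq>\<^bsub>Sub C M X\<^esub> p} \<in> carrier (Fil C M X)"
proof -
  interpret L: complete_lattice "Sub C M X"
    by (rule Sub_complete_lattice[OF X])
  let ?F = "{p \<in> carrier (Sub C M X). a \<sqsubseteq>\<^bsub>Sub C M X\<^esub> p}"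
  have inf: "\<Sqinter>\<^bsub>Sub C M X\<^esub> S \<in> ?F" if S: "S \<subseteq> ?F" for S
  proof -
    have sub: "S \<subseteq> carrier (Sub C M X)"
      using S by blast
    have "a \<sqsubseteq>\<^bsub>Sub C M X\<^esub> \<Sqinter>\<^bsub>Sub C M X\<^esub> S"
      by (rule L.weak.inf_greatest[OF sub a]) (use S in blast)
    then show ?thesis
      using L.weak.inf_closed[OF sub] by simp
  qed
  have up: "q \<in> ?F" if "p \<in> ?F" "q \<in> carrier (Sub C M X)" "p \<sqsubseteq>\<^bsub>Sub C M X\<^esub> q" for p q
    using that a L.le_trans[of a p q] by simp
  have "?F \<subseteq> carrier (Sub C M X)"
    by blast
  moreover have "\<forall>p \<in> ?F. \<forall>q \<in> carrier (Sub C M X). p \<sqsubseteq>\<^bsub>Sub C M X\<^esub> q \<longrightarrow> q \<in> ?F"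
    using up by blast
  moreover have "\<forall>S. S \<subseteq> ?F \<and> finite S \<longrightarrow> \<Sqinter>\<^bsub>Sub C M X\<^esub> S \<in> ?F"
    using inf by blast
  ultimately show ?thesis
    unfolding Fil_def partial_object.simps by (intro CollectI conjI)
qed

lemma Phi_closed:
  assumes X: "X \<in> Obj C" and c: "c \<in> carrier (EGM C E M X)"
  shows "Phi C M X c \<in> carrier (pnhd C E M X)"
proof -
  interpret L: complete_lattice "Sub C M X"
    by (rule Sub_complete_lattice[OF X])
  have closed: "c x \<in> carrier (Sub C M X)" if "x \<in> carrier (Sub C M X)" for x
    using that c by (auto simp: carrier_EGM_iff)
  have mono: "c x \<sqsubseteq>\<^bsub>Sub C M X\<^esub> c y"
    if "x \<in> carrier (Sub C M X)" "y \<in> carrier (Sub C M X)" "x \<sqsubseteq>\<^bsub>Sub C M X\<^esub> y" for x y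
    using that c by (auto simp: carrier_EGM_iff isotone_def)
  have ext: "x \<sqsubseteq>\<^bsub>Sub C M X\<^esub> c x" if "x \<in> carrier (Sub C M X)" for x
    using that c by (auto simp: carrier_EGM_iff)
  have sigma: "sigma C E M X \<in> carrier (Sub C M X)"
    "\<And>x. x \<in> carrier (Sub C M X) \<Longrightarrow> sigma C E M X \<sqsubseteq>\<^bsub>Sub C M X\<^esub> x"
    "c (sigma C E M X) = sigma C E M X"
    using sigma_least[OF X] c by (auto simp: least_def carrier_EGM_iff)
  have "Phi C M X c \<in> carrier (Sub C M X) \<rightarrow>\<^sub>E carrier (Fil C M X)"
    using principal_filter[OF X closed] by (auto simp: Phi_def)
  moreover have "isotone (inv_gorder (Sub C M X)) (Fil C M X) (Phi C M X c)"
  proof (rule isotoneI)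
    show "weak_partial_order (inv_gorder (Sub C M X))"
      by (rule L.dual_weak_order)
    show "weak_partial_order (Fil C M X)"
      by (rule partial_order.axioms(1)[OF partial_order_Fil])
    fix x y
    assume "x \<in> carrier (inv_gorder (Sub C M X))" "y \<in> carrier (inv_gorder (Sub C M X))"
      "x \<sqsubseteq>\<^bsub>inv_gorder (Sub C M X)\<^esub> y"
    then have xy: "x \<in> carrier (Sub C M X)" "y \<in> carrier (Sub C M X)" "y \<sqsubseteq>\<^bsub>Sub C M X\<^esub> x"
      by simp_all
    have "Phi C M X c x \<subseteq> Phi C M X c y"
      using xy L.le_trans[OF mono[OF xy(2,1,3)]] closed by (auto simp: Phi_def)
    then show "Phi C M X c x \<sqsubseteq>\<^bsub>Fil C M X\<^esub> Phi C M X c y"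
      by (simp add: Fil_def)
  qed
  moreover have "Phi C M X c (sigma C E M X) = carrier (Sub C M X)"
    using sigma by (auto simp: Phi_def)
  moreover have "m \<sqsubseteq>\<^bsub>Sub C M X\<^esub> p" if "m \<in> carrier (Sub C M X)" "p \<in> Phi C M X c m" for m p
    using that L.le_trans[OF ext[OF that(1)]] closed by (auto simp: Phi_def)
  ultimately show ?thesis
    by (simp add: carrier_pnhd_iff)
qed

lemma Psi_closed:
  assumes X: "X \<in> Obj C" and \<mu>: "\<mu> \<in> carrier (pnhd C E M X)"
  shows "Psi C M X \<mu> \<in> carrier (EGM C E M X)"
proof -
  interpret L: complete_lattice "Sub C M X"
    by (rule Sub_complete_lattice[OF X])
  have sub: "\<mu> x \<subseteq> carrier (Sub C M X)" if "x \<in> carrier (Sub C M X)" for x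
    using \<mu> that by (rule pnhd_subset)
  have closed: "Psi C M X \<mu> x \<in> carrier (Sub C M X)" if "x \<in> carrier (Sub C M X)" for x
    using that sub by (simp add: Psi_def)
  have anti: "\<mu> y \<subseteq> \<mu> x"
    if "x \<in> carrier (Sub C M X)" "y \<in> carrier (Sub C M X)" "x \<sqsubseteq>\<^bsub>Sub C M X\<^esub> y" for x y
    using that \<mu> by (simp add: carrier_pnhd_iff isotone_def Fil_def)
  have sigma: "sigma C E M X \<in> carrier (Sub C M X)"
    "\<And>x. x \<in> carrier (Sub C M X) \<Longrightarrow> sigma C E M X \<sqsubseteq>\<^bsub>Sub C M X\<^esub> x"
    using sigma_least[OF X] by (auto simp: least_def)
  have "Psi C M X \<mu> \<in> carrier (Sub C M X) \<rightarrow>\<^sub>E carrier (Sub C M X)"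
    using sub by (auto simp: Psi_def)
  moreover have "isotone (Sub C M X) (Sub C M X) (Psi C M X \<mu>)"
  proof (rule isotoneI)
    fix x y
    assume xy: "x \<in> carrier (Sub C M X)" "y \<in> carrier (Sub C M X)" "x \<sqsubseteq>\<^bsub>Sub C M X\<^esub> y"
    have "\<Sqinter>\<^bsub>Sub C M X\<^esub> (\<mu> x) \<sqsubseteq>\<^bsub>Sub C M X\<^esub> \<Sqinter>\<^bsub>Sub C M X\<^esub> (\<mu> y)"
      by (rule L.weak.inf_greatest)
        (use sub xy anti[OF xy] in \<open>auto intro: L.weak.inf_lower\<close>)
    then show "Psi C M X \<mu> x \<sqsubseteq>\<^bsub>Sub C M X\<^esub> Psi C M X \<mu> y"
      using xy by (simp add: Psi_def)
  qed (rule L.weak_partial_order_axioms)+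
  moreover have "x \<sqsubseteq>\<^bsub>Sub C M X\<^esub> Psi C M X \<mu> x" if "x \<in> carrier (Sub C M X)" for x
    using that sub \<mu> by (auto simp: Psi_def carrier_pnhd_iff intro!: L.weak.inf_greatest)
  moreover have "Psi C M X \<mu> (sigma C E M X) = sigma C E M X"
  proof (rule L.le_antisym)
    have "\<mu> (sigma C E M X) = carrier (Sub C M X)"
      using \<mu> by (simp add: carrier_pnhd_iff)
    then show "Psi C M X \<mu> (sigma C E M X) \<sqsubseteq>\<^bsub>Sub C M X\<^esub> sigma C E M X"
      using sigma by (auto simp: Psi_def intro: L.weak.inf_lower)
  qed (use sigma closed in auto)
  ultimately show ?thesis
    by (simp add: carrier_EGM_iff)
qed

lemma Phi_Psi_adjoint:
  assumes X: "X \<in> Obj C" and c: "c \<in> carrier (EGM C E M X)"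
    and \<mu>: "\<mu> \<in> carrier (pnhd C E M X)"
  shows "\<mu> \<sqsubseteq>\<^bsub>pnhd C E M X\<^esub> Phi C M X c \<longleftrightarrow> c \<sqsubseteq>\<^bsub>EGM C E M X\<^esub> Psi C M X \<mu>"
proof -
  interpret L: complete_lattice "Sub C M X"
    by (rule Sub_complete_lattice[OF X])
  have "\<mu> x \<subseteq> Phi C M X c x \<longleftrightarrow> c x \<sqsubseteq>\<^bsub>Sub C M X\<^esub> Psi C M X \<mu> x"
    if x: "x \<in> carrier (Sub C M X)" for x
  proof -
    have sub: "\<mu> x \<subseteq> carrier (Sub C M X)"
      using \<mu> x by (rule pnhd_subset)
    have cx: "c x \<in> carrier (Sub C M X)"
      using x c by (auto simp: carrier_EGM_iff)
    have "\<mu> x \<subseteq> Phi C M X c x \<longleftrightarrow> (\<forall>p \<in> \<mu> x. c x \<sqsubseteq>\<^bsub>Sub C M X\<^esub> p)"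
      using sub x by (auto simp: Phi_def)
    also have "\<dots> \<longleftrightarrow> c x \<sqsubseteq>\<^bsub>Sub C M X\<^esub> \<Sqinter>\<^bsub>Sub C M X\<^esub> (\<mu> x)"
      using sub cx by (meson L.inf_closed L.weak.inf_greatest L.weak.inf_lower L.le_trans subsetD)
    finally show ?thesis
      using x by (simp add: Psi_def)
  qed
  then show ?thesis
    by (simp add: le_pnhd_iff le_EGM_iff)
qed

lemma Psi_Phi:
  assumes X: "X \<in> Obj C" and c: "c \<in> carrier (EGM C E M X)"
  shows "Psi C M X (Phi C M X c) = c"
proof (rule PiE_ext)
  interpret L: complete_lattice "Sub C M X"
    by (rule Sub_complete_lattice[OF X])
  show "Psi C M X (Phi C M X c) \<in> carrier (Sub C M X) \<rightarrow>\<^sub>E carrier (Sub C M X)"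
    using Psi_closed[OF X Phi_closed[OF X c]] by (simp add: carrier_EGM_iff)
  show "c \<in> carrier (Sub C M X) \<rightarrow>\<^sub>E carrier (Sub C M X)"
    using c by (simp add: carrier_EGM_iff)
  fix x
  assume x: "x \<in> carrier (Sub C M X)"
  then have cx: "c x \<in> carrier (Sub C M X)"
    using c by (auto simp: carrier_EGM_iff)
  let ?F = "{p \<in> carrier (Sub C M X). c x \<sqsubseteq>\<^bsub>Sub C M X\<^esub> p}"
  have F: "?F \<subseteq> carrier (Sub C M X)"
    by blast
  have "\<Sqinter>\<^bsub>Sub C M X\<^esub> ?F = c x"
  proof (rule L.le_antisym)
    show "\<Sqinter>\<^bsub>Sub C M X\<^esub> ?F \<sqsubseteq>\<^bsub>Sub C M X\<^esub> c x"
      by (rule L.weak.inf_lower[OF F]) (use cx in auto)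
    show "c x \<sqsubseteq>\<^bsub>Sub C M X\<^esub> \<Sqinter>\<^bsub>Sub C M X\<^esub> ?F"
      by (rule L.weak.inf_greatest[OF F cx]) auto
  qed (use F cx in auto)
  then show "Psi C M X (Phi C M X c) x = c x"
    using x by (simp add: Psi_def Phi_def)
qed

end

theorem mainTheorem5:
  fixes A :: "('o, 'a) category" and E M :: "'a set" and X :: 'o
  assumes "neighbourhood_context A E M"
    and "X \<in> Obj A"
  shows "galois_connection
      \<lparr> orderA = EGM A E M X, orderB = inv_gorder (pnhd A E M X),
        lower = Phi A M X, upper = Psi A M X \<rparr> \<and>
    (\<forall>c \<in> carrier (EGM A E M X). Psi A M X (Phi A M X c) = c)"
proof -
  interpret neighbourhood_context A E M
    by (rule assms(1))
  note X = assms(2)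
  have "partial_order (inv_gorder (pnhd A E M X))"
    by (rule partial_order.dual_order[OF partial_order_pnhd])
  then have "galois_connection
      \<lparr> orderA = EGM A E M X, orderB = inv_gorder (pnhd A E M X),
        lower = Phi A M X, upper = Psi A M X \<rparr>"
    by (intro galois_connection.intro connection.intro galois_connection_axioms.intro)
      (simp_all add: partial_order_EGM[OF X] Phi_closed[OF X] Psi_closed[OF X]
        Phi_Psi_adjoint[OF X])
  then show ?thesis
    using Psi_Phi[OF X] by blast
qed

end
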